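(* Let $\Gamma=\bigcup_{j=1}^s\Gamma_j\subset\mathbb{C}$, where for each $1\le j\le s$ the arc $\Gamma_j=z_j([a_j,b_j])$, $a_j<b_j$, is the image of a map $z_j$ that is either an algebraic polynomial with complex coefficients of degree $k_j\ge1$, or a trigonometric polynomial with complex coefficients of degree $k_j\ge1$ (with $b_j-a_j\le2\pi$ in the trigonometric case). Let $K\subset\mathbb{C}$ be a compact set with $\partial K_{out}\subseteq\Gamma\subseteq K$, where $\partial K_{out}$ is the boundary of the unbounded connected component of $\mathbb{C}\setminus K$. For $n\ge1$ and $m>1$ let $Z_n^m=\bigcup_{j=1}^sZ_n^m(k_j)\subset\Gamma$ be the union of mapped Chebyshev points defined in the context ($m$ being such that all numbers $N_j$ there are integers). Let $L_n:C(K)\to\mathbb{P}_n(\mathbb{C})$ be a linear projection operator of the form $$L_nf(z)=\sum_{i=1}^M f(\xi_i)\,\phi_i(z),$$ where $\Xi=\{\xi_1,\dots,\xi_M\}\subset K$ is a set of $M$ distinct points and $\{\phi_1,\dots,\phi_M\}$ is a set of generators of $\mathbb{P}_n(\mathbb{C})$; let $\lambda_n(z)=\sum_{i=1}^M|\phi_i(z)|$ and $\|L_n\|=\sup_{f\ne0}\|L_nf\|_K/\|f\|_K$. Then for every $n\ge1$ and $m>1$ $$\|\lambda_n\|_{Z_n^m}\le\|L_n\|\le c_m\|\lambda_n\|_{Z_n^m}$$ and $$0\le\|L_n\|-\|\lambda_n\|_{Z_n^m}\le(c_m-1)\|L_n\|,$$ where $c_m=1/\cos(\pi/(2m))$.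
   Context: $\mathbb{P}_n(\mathbb{C})$ is the space of polynomials in one complex variable with complex coefficients of degree at most $n$. $C(K)$ is the space of continuous complex-valued functions on $K$. For a compact set $Y$ (continuous or discrete), $\|\cdot\|_Y$ is the sup-norm on $Y$. "Projection" means $L_np=p$ for all $p\in\mathbb{P}_n(\mathbb{C})$. A trigonometric polynomial of degree at most $\nu$ with complex coefficients is a complex linear combination of $1,\cos(jt),\sin(jt)$, $1\le j\le\nu$. Chebyshev points: for a positive integer $N$, $\mathcal{T}_N$ denotes either the set of $N$ Chebyshev zeros $\cos((2i-1)\pi/(2N))$, $1\le i\le N$, or the set of $N+1$ Chebyshev extrema $\cos(i\pi/N)$, $0\le i\le N$ (the result holds for either choice). Mapped points: $Z_n^m(k_j)=z_j(\sigma_j(\mathcal{T}_{N_j}))$, where - if $z_j$ is algebraic, $N_j=mnk_j$ and $\sigma_j(u)=\frac{b_j-a_j}{2}u+\frac{b_j+a_j}{2}$, $u\in[-1,1]$; - if $z_j$ is trigonometric, $N_j=2mnk_j$ and $\sigma_j(u)=2\arcsin\left(u\sin\left(\frac{b_j-a_j}{4}\right)\right)+\frac{b_j+a_j}{2}$, $u\in[-1,1]$. *)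

theory Defs
  imports "HOL-Analysis.Analysis" "HOL-Computational_Algebra.Polynomial"
begin

definition Pn :: "nat \<Rightarrow> complex poly set" where
  "Pn n = {p. degree p \<le> n}"

definition sup_norm :: "'a set \<Rightarrow> ('a \<Rightarrow> 'b::real_normed_vector) \<Rightarrow> real" where
  "sup_norm Y g = (SUP z\<in>Y. norm (g z))"

(* For bounded K, outside K is the unbounded connected component of the complement. *)
definition outer_boundary :: "complex set \<Rightarrow> complex set" where
  "outer_boundary K = frontier (outside K)"

definition is_alg_poly :: "(real \<Rightarrow> complex) \<Rightarrow> nat \<Rightarrow> bool" where
  "is_alg_poly z k \<longleftrightarrow> (\<exists>p :: complex poly. degree p = k \<and> (\<forall>t. z t = poly p (of_real t)))"

definition is_trig_poly_le :: "(real \<Rightarrow> complex) \<Rightarrow> nat \<Rightarrow> bool" where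
  "is_trig_poly_le z \<nu> \<longleftrightarrow> (\<exists>\<alpha> \<beta> :: nat \<Rightarrow> complex. \<forall>t. z t =
     \<alpha> 0 + (\<Sum>j = 1..\<nu>. \<alpha> j * of_real (cos (real j * t)) + \<beta> j * of_real (sin (real j * t))))"

definition is_trig_poly :: "(real \<Rightarrow> complex) \<Rightarrow> nat \<Rightarrow> bool" where
  "is_trig_poly z k \<longleftrightarrow> is_trig_poly_le z k \<and> (\<forall>\<nu><k. \<not> is_trig_poly_le z \<nu>)"

definition cheb_zeros :: "nat \<Rightarrow> real set" where
  "cheb_zeros N = (\<lambda>i. cos ((2 * real i - 1) * pi / (2 * real N))) ` {1..N}"

definition cheb_extrema :: "nat \<Rightarrow> real set" where
  "cheb_extrema N = (\<lambda>i. cos (real i * pi / real N)) ` {0..N}"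

datatype arc_kind = Algebraic | Trigonometric

fun is_arc_map :: "arc_kind \<Rightarrow> (real \<Rightarrow> complex) \<Rightarrow> nat \<Rightarrow> real \<Rightarrow> real \<Rightarrow> bool" where
  "is_arc_map Algebraic z k a b \<longleftrightarrow> is_alg_poly z k"
| "is_arc_map Trigonometric z k a b \<longleftrightarrow> is_trig_poly z k \<and> b - a \<le> 2 * pi"

fun num_points :: "arc_kind \<Rightarrow> real \<Rightarrow> nat \<Rightarrow> nat \<Rightarrow> real" where
  "num_points Algebraic m n k = m * real n * real k"
| "num_points Trigonometric m n k = 2 * m * real n * real k"

fun cheb_map :: "arc_kind \<Rightarrow> real \<Rightarrow> real \<Rightarrow> real \<Rightarrow> real" where
  "cheb_map Algebraic a b u = (b - a) / 2 * u + (b + a) / 2"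
| "cheb_map Trigonometric a b u = 2 * arcsin (u * sin ((b - a) / 4)) + (b + a) / 2"

definition mapped_points ::
  "(nat \<Rightarrow> real set) \<Rightarrow> arc_kind \<Rightarrow> (real \<Rightarrow> complex) \<Rightarrow> real \<Rightarrow> real \<Rightarrow> nat \<Rightarrow> complex set" where
  "mapped_points T \<kappa> z a b N = z ` cheb_map \<kappa> a b ` T N"

(* Elements of C(K) are represented by functions on the whole plane that are continuous on K. *)
definition linear_projection :: "complex set \<Rightarrow> nat \<Rightarrow> ((complex \<Rightarrow> complex) \<Rightarrow> complex poly) \<Rightarrow> bool" where
  "linear_projection K n L \<longleftrightarrow>
     (\<forall>f. continuous_on K f \<longrightarrow> L f \<in> Pn n) \<and>
     (\<forall>f g. continuous_on K f \<longrightarrow> continuous_on K g \<longrightarrow> L (\<lambda>w. f w + g w) = L f + L g) \<and>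
     (\<forall>c f. continuous_on K f \<longrightarrow> L (\<lambda>w. c * f w) = smult c (L f)) \<and>
     (\<forall>p \<in> Pn n. L (poly p) = p)"

definition op_norm :: "complex set \<Rightarrow> ((complex \<Rightarrow> complex) \<Rightarrow> complex poly) \<Rightarrow> real" where
  "op_norm K L = (SUP f \<in> {f. continuous_on K f \<and> (\<exists>w\<in>K. f w \<noteq> 0)}.
     sup_norm K (poly (L f)) / sup_norm K f)"

definition lebesgue_fun :: "(nat \<Rightarrow> complex poly) \<Rightarrow> nat \<Rightarrow> complex \<Rightarrow> real" where
  "lebesgue_fun \<phi> M w = (\<Sum>i = 1..M. cmod (poly (\<phi> i) w))"

definition cheb_const :: "real \<Rightarrow> real" where
  "cheb_const m = 1 / cos (pi / (2 * m))"

end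

theory Submission
  imports Defs "HOL-Complex_Analysis.Conformal_Mappings"
begin

text \<open>
  The upper bound follows from the norming inequality \<open>\<parallel>p\<parallel>\<^sub>K \<le> c\<^sub>m \<parallel>p\<parallel>\<^sub>Z\<close> for polynomials of
  degree at most \<open>n\<close>, applied to \<open>p = L f\<close>; the lower bound interpolates the conjugate signs of
  the \<open>\<phi>\<^sub>i(w)\<close> at the points \<open>\<xi>\<^sub>i\<close> by a continuous function of norm at most 1 (Tietze). By the
  maximum principle the norming inequality reduces to each arc. There let \<open>D\<close> be \<open>n k\<close> in the
  algebraic and \<open>2 n k\<close> in the trigonometric case, and parametrise the arc by \<open>u = cos \<theta>\<close>.
  After rotating and rescaling, the real part \<open>F\<close> of \<open>p\<close> on the arc satisfies \<open>\<bar>F\<bar> \<le> 1\<close> and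
  \<open>F(cos \<theta>\<^sub>0) = 1\<close> for some \<open>\<theta>\<^sub>0\<close>. A zero count in the style of M. Riesz then gives
  \<open>F(cos \<theta>) \<ge> cos(D(\<theta> - \<theta>\<^sub>0))\<close> for \<open>\<bar>\<theta> - \<theta>\<^sub>0\<bar> < \<pi>/D\<close>, and some Chebyshev node of order \<open>N = m D\<close>
  has angle within \<open>\<pi>/(2N)\<close> of \<open>\<theta>\<^sub>0\<close>.
\<close>

section \<open>Comparison with a cosine\<close>

text \<open>
  With \<open>Q(cos \<theta>) = cos(D \<theta>)\<close>, the product of \<open>F(cos \<theta>) - l cos(D \<theta> - \<beta>)\<close> and its reflection under
  \<open>\<theta> \<mapsto> -\<theta>\<close> has the form below with \<open>A = 2 l cos \<beta>\<close>, \<open>B = l\<^sup>2\<close>, \<open>c = sin\<^sup>2 \<beta>\<close>: passing to the product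
  removes \<open>sin(D \<theta>)\<close>, which in the trigonometric case does not lie in the space containing \<open>F\<close>.
  The zeros are counted in the open interval because \<open>u = -1\<close> and \<open>u = 1\<close> may represent the same
  point modulo \<open>2\<pi>\<close>.
\<close>
definition zero_bound :: "nat \<Rightarrow> (real \<Rightarrow> real) \<Rightarrow> (real \<Rightarrow> real) \<Rightarrow> bool" where
  "zero_bound D F Q \<longleftrightarrow> (\<forall>A B c X. X \<subseteq> {-1<..<1} \<longrightarrow> finite X \<longrightarrow> card X > 2 * D \<longrightarrow>
     (\<forall>u\<in>X. (F u)\<^sup>2 - A * F u * Q u + B * ((Q u)\<^sup>2 - c) = 0) \<longrightarrow>
     (\<forall>u\<in>{-1..1}. (F u)\<^sup>2 - A * F u * Q u + B * ((Q u)\<^sup>2 - c) = 0))"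

lemma ex_open_interval_avoiding_countable:
  fixes a b :: real
  assumes "a < b" "countable S"
  obtains x where "a < x" "x < b" "x \<notin> S"
proof -
  have "\<not> {a<..<b} \<subseteq> S"
    using assms countable_subset uncountable_open_interval by metis
  then show ?thesis using that by fastforce
qed

lemma ex_zero_between:
  fixes g :: "real \<Rightarrow> real"
  assumes "continuous_on UNIV g" "x < y" "g x * g y < 0"
  obtains r where "x < r" "r < y" "g r = 0"
proof -
  have c: "continuous_on {x..y} g" using assms(1) continuous_on_subset by blast
  have "\<exists>r. x \<le> r \<and> r \<le> y \<and> g r = 0"
  proof (cases "g x < 0")
    case True
    then have "g y > 0" using assms(3) by (simp add: mult_less_0_iff)
    then show ?thesis using IVT'[of g x 0 y] c True assms(2) by force
  next
    case False
    then have "g x > 0" "g y < 0" using assms(3) by (auto simp: mult_less_0_iff)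
    then show ?thesis using IVT2'[of g y 0 x] c assms(2) by force
  qed
  then obtain r where r: "x \<le> r" "r \<le> y" "g r = 0" by blast
  moreover have "r \<noteq> x" "r \<noteq> y" using assms(3) r(3) by auto
  ultimately show ?thesis using that by force
qed

text \<open>
  If the claim fails, shift and enlarge the cosine slightly, so that its peak just left of
  \<open>\<theta>\<^sub>0\<close> lies above \<open>F\<close> but \<open>F\<close> is still above it at \<open>\<theta>\<^sub>0\<close>. The difference then has \<open>2D\<close> forced sign
  changes in a period plus two more. Choosing the parameters \<open>\<epsilon>\<close> and \<open>l\<close> outside a countable set keeps
  the zeros away from \<open>sin(D \<theta>) = 0\<close>, so no two of them have the same cosine.
\<close>
lemma comparison_pos:
  fixes F Q :: "real \<Rightarrow> real" and D :: nat
  assumes D: "D \<ge> 1" and cont: "continuous_on {-1..1} F"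
    and bound: "\<And>u. u \<in> {-1..1} \<Longrightarrow> \<bar>F u\<bar> \<le> 1"
    and Q: "\<And>\<theta>. Q (cos \<theta>) = cos (real D * \<theta>)"
    and zb: "zero_bound D F Q"
    and max: "F (cos \<theta>\<^sub>0) = 1"
    and \<theta>\<^sub>1: "\<theta>\<^sub>0 < \<theta>\<^sub>1" "\<theta>\<^sub>1 - \<theta>\<^sub>0 < pi / real D"
  shows "cos (real D * (\<theta>\<^sub>1 - \<theta>\<^sub>0)) \<le> F (cos \<theta>\<^sub>1)"
proof (rule ccontr)
  assume "\<not> ?thesis"
  then have less: "F (cos \<theta>\<^sub>1) < cos (real D * (\<theta>\<^sub>1 - \<theta>\<^sub>0))" by simp
  define \<delta> where "\<delta> = \<theta>\<^sub>1 - \<theta>\<^sub>0"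
  define d where "d = real D"
  have d: "d \<ge> 1" using D by (simp add: d_def)
  have \<delta>: "\<delta> > 0" "\<delta> < pi / d" using \<theta>\<^sub>1 by (auto simp: \<delta>_def d_def)
  \<comment> \<open>The strict inequality at \<open>\<theta>\<^sub>1\<close> survives a small shift
    of the peak from \<open>\<theta>\<^sub>0\<close> to
    \<open>\<theta>\<^sub>0 - \<epsilon>\<close>. The bound
    \<open>\<epsilon> < pi / d - \<delta>\<close> keeps \<open>\<theta>\<^sub>1\<close> to the left
    of the next trough.\<close>
  have "eventually (\<lambda>\<epsilon>. F (cos \<theta>\<^sub>1) < cos (d * (\<delta> + \<epsilon>))) (at_right 0)"
  proof (rule order_tendstoD)
    show "((\<lambda>\<epsilon>. cos (d * (\<delta> + \<epsilon>))) \<longlongrightarrow> cos (d * (\<delta> + 0))) (at_right 0)"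
      by (intro tendsto_intros)
  qed (use less in \<open>simp add: \<delta>_def d_def\<close>)
  moreover have "eventually (\<lambda>\<epsilon>. \<epsilon> < pi / d - \<delta>) (at_right 0)"
    using \<delta> by (intro order_tendstoD(2)[OF tendsto_ident_at]) auto
  moreover have "eventually (\<lambda>\<epsilon>. \<epsilon> < pi / (2 * d)) (at_right 0)"
    using d by (intro order_tendstoD(2)[OF tendsto_ident_at]) auto
  ultimately have "eventually (\<lambda>\<epsilon>. F (cos \<theta>\<^sub>1) < cos (d * (\<delta> + \<epsilon>)) \<and> \<epsilon> < pi / d - \<delta> \<and> \<epsilon> < pi / (2 * d)) (at_right 0)"
    by eventually_elim auto
  then obtain r where r: "r > 0"
    "\<And>\<epsilon>. 0 < \<epsilon> \<Longrightarrow> \<epsilon> < r \<Longrightarrow> F (cos \<theta>\<^sub>1) < cos (d * (\<delta> + \<epsilon>)) \<and> \<epsilon> < pi / d - \<delta> \<and> \<epsilon> < pi / (2 * d)"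
    unfolding eventually_at_right_field by blast
  \<comment> \<open>The excluded shifts are those that make twice the phase \<open>\<beta>\<close>
    of the shifted cosine a multiple of \<open>pi\<close>.\<close>
  obtain \<epsilon> where "0 < \<epsilon>" "\<epsilon> < r"
    and \<epsilon>_gen: "\<epsilon> \<notin> range (\<lambda>i::int. \<theta>\<^sub>0 - of_int i * pi / (2 * d))"
    using ex_open_interval_avoiding_countable[OF r(1)] by (metis countable_image countableI_type)
  with r(2) have \<epsilon>: "\<epsilon> > 0" "F (cos \<theta>\<^sub>1) < cos (d * (\<delta> + \<epsilon>))" "\<epsilon> < pi / d - \<delta>" "\<epsilon> < pi / (2 * d)"
    by blast+
  define \<beta> where "\<beta> = d * (\<theta>\<^sub>0 - \<epsilon>)"
  have "sin (2 * \<beta>) \<noteq> 0"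
  proof
    assume "sin (2 * \<beta>) = 0"
    then obtain i :: int where "2 * \<beta> = of_int i * pi" by (auto simp: sin_zero_iff_int2)
    then have "\<epsilon> = \<theta>\<^sub>0 - of_int i * pi / (2 * d)" using d by (simp add: \<beta>_def field_simps)
    then show False using \<epsilon>_gen by blast
  qed
  then have \<beta>: "sin \<beta> \<noteq> 0" "cos \<beta> \<noteq> 0" by (auto simp: sin_double)
  have cosde: "cos (d * \<epsilon>) < 1" "cos (d * \<epsilon>) > 0"
  proof -
    have "0 < d * \<epsilon>" "d * \<epsilon> < pi / 2" using d \<epsilon> by (auto simp: field_simps)
    then show "cos (d * \<epsilon>) < 1" "cos (d * \<epsilon>) > 0"
      using cos_monotone_0_pi[of 0 "d * \<epsilon>"] cos_gt_zero by auto
  qed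
  have "eventually (\<lambda>l. F (cos \<theta>\<^sub>1) < l * cos (d * (\<delta> + \<epsilon>))) (at_right (1::real))"
  proof (rule order_tendstoD)
    show "((\<lambda>l. l * cos (d * (\<delta> + \<epsilon>))) \<longlongrightarrow> 1 * cos (d * (\<delta> + \<epsilon>))) (at_right 1)"
      by (intro tendsto_intros)
  qed (use \<epsilon> in simp)
  moreover have "eventually (\<lambda>l. l * cos (d * \<epsilon>) < 1) (at_right (1::real))"
  proof (rule order_tendstoD)
    show "((\<lambda>l. l * cos (d * \<epsilon>)) \<longlongrightarrow> 1 * cos (d * \<epsilon>)) (at_right 1)"
      by (intro tendsto_intros)
  qed (use cosde in simp)
  ultimately have "eventually (\<lambda>l. F (cos \<theta>\<^sub>1) < l * cos (d * (\<delta> + \<epsilon>)) \<and> l * cos (d * \<epsilon>) < 1) (at_right (1::real))"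
    by eventually_elim auto
  then obtain \<mu> where \<mu>: "\<mu> > 1"
    "\<And>l. 1 < l \<Longrightarrow> l < \<mu> \<Longrightarrow> F (cos \<theta>\<^sub>1) < l * cos (d * (\<delta> + \<epsilon>)) \<and> l * cos (d * \<epsilon>) < 1"
    unfolding eventually_at_right_field by blast
  \<comment> \<open>The excluded set contains every amplitude for which the difference
    \<open>g\<close> below vanishes at a multiple of \<open>pi / d\<close>; there the cosine term
    equals \<open>l * cos \<beta>\<close> up to sign.\<close>
  obtain l where "1 < l" "l < \<mu>"
    and l_gen: "l \<notin> range (\<lambda>i::int. F (cos (of_int i * pi / d)) / cos \<beta>)
      \<union> range (\<lambda>i::int. - F (cos (of_int i * pi / d)) / cos \<beta>)"
    using ex_open_interval_avoiding_countable[OF \<mu>(1)] by (metis countable_image countableI_type countable_Un)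
  with \<mu>(2) have l: "l > 1" "F (cos \<theta>\<^sub>1) < l * cos (d * (\<delta> + \<epsilon>))" "l * cos (d * \<epsilon>) < 1"
    by blast+
  define g where "g = (\<lambda>\<theta>. F (cos \<theta>) - l * cos (d * \<theta> - \<beta>))"
  \<comment> \<open>A peak of the comparison cosine. At its extrema \<open>p + j * pi / d\<close>
    the sign of \<open>g\<close> is forced and alternates, because \<bar>F\<bar> \<le> 1 <
    l.\<close>
  define p where "p = \<theta>\<^sub>0 - \<epsilon>"
  have g_cont: "continuous_on UNIV g"
    unfolding g_def
    by (intro continuous_intros continuous_on_compose2[OF cont]) auto
  have F1: "\<bar>F (cos x)\<bar> \<le> 1" for x using bound by simp
  have g_p: "g (p + real j * pi / d) * (-1) ^ j < 0" for j
  proof -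
    have "d * (p + real j * pi / d) - \<beta> = real j * pi"
      using d by (simp add: p_def \<beta>_def field_simps)
    then have "g (p + real j * pi / d) = F (cos (p + real j * pi / d)) - l * (-1) ^ j"
      by (simp add: g_def)
    then have "g (p + real j * pi / d) * (-1) ^ j = F (cos (p + real j * pi / d)) * (-1) ^ j - l"
      by (cases "even j") auto
    moreover have "F (cos (p + real j * pi / d)) * (-1) ^ j \<le> 1"
      using F1[of "p + real j * pi / d"] by (cases "even j") auto
    ultimately show ?thesis using l by linarith
  qed
  have g0: "g \<theta>\<^sub>0 > 0"
    using l(3) max by (simp add: g_def \<beta>_def algebra_simps)
  have g1: "g \<theta>\<^sub>1 < 0"
  proof -
    have "d * \<theta>\<^sub>1 - \<beta> = d * (\<delta> + \<epsilon>)" by (simp add: \<beta>_def \<delta>_def algebra_simps)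
    then show ?thesis using l(2) by (simp add: g_def)
  qed
  have gp0: "g p < 0" using g_p[of 0] by simp
  have gp1: "g (p + pi / d) > 0" using g_p[of 1] by simp
  have "\<exists>x. p + real j * pi / d < x \<and> x < p + real (Suc j) * pi / d \<and> g x = 0" for j
  proof -
    have "g (p + real j * pi / d) * g (p + real (Suc j) * pi / d) < 0"
      using g_p[of j] g_p[of "Suc j"] by (cases "even j") (auto simp: mult_less_0_iff)
    moreover have "p + real j * pi / d < p + real (Suc j) * pi / d"
      using d by (simp add: divide_strict_right_mono)
    ultimately show ?thesis using ex_zero_between[OF g_cont] by metis
  qed
  then obtain \<zeta> where \<zeta>: "\<And>j. p + real j * pi / d < \<zeta> j" "\<And>j. \<zeta> j < p + real (Suc j) * pi / d"
    "\<And>j. g (\<zeta> j) = 0"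
    by metis
  \<comment> \<open>At \<open>p\<close>, \<open>\<theta>\<^sub>0\<close>,
    \<open>\<theta>\<^sub>1\<close> and \<open>p + pi / d\<close> the signs of \<open>g\<close> are
    -, +, -, +, which gives three zeros where the alternation alone forces one.\<close>
  obtain x1 where x1: "p < x1" "x1 < \<theta>\<^sub>0" "g x1 = 0"
    using ex_zero_between[OF g_cont, of p \<theta>\<^sub>0] gp0 g0 \<epsilon>(1) by (auto simp: p_def mult_less_0_iff)
  obtain x2 where x2: "\<theta>\<^sub>0 < x2" "x2 < \<theta>\<^sub>1" "g x2 = 0"
    using ex_zero_between[OF g_cont, of \<theta>\<^sub>0 \<theta>\<^sub>1] g1 g0 \<theta>\<^sub>1 by (auto simp: mult_less_0_iff)
  obtain x3 where x3: "\<theta>\<^sub>1 < x3" "x3 < p + pi / d" "g x3 = 0"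
    using ex_zero_between[OF g_cont, of \<theta>\<^sub>1 "p + pi / d"] g1 gp1 \<epsilon>(3) by (auto simp: mult_less_0_iff p_def \<delta>_def)
  \<comment> \<open>The three zeros replace \<open>\<zeta> 0\<close>, so there are
    \<open>3 + (2 * D - 1)\<close> of them, all within one open period.\<close>
  define A where "A = {x1, x2, x3} \<union> \<zeta> ` {1..<2 * D}"
  have \<zeta>_mono: "\<zeta> i < \<zeta> j" if "i < j" for i j
  proof -
    have "real (Suc i) * pi / d \<le> real j * pi / d"
      using that d by (intro divide_right_mono mult_right_mono) auto
    then show ?thesis using \<zeta>(2)[of i] \<zeta>(1)[of j] by linarith
  qed
  have "inj \<zeta>" using \<zeta>_mono by (metis injI less_irrefl nat_neq_iff)
  then have "card (\<zeta> ` {1..<2 * D}) = 2 * D - 1"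
    by (subst card_image) (auto intro: inj_on_subset)
  moreover have \<zeta>_ge: "p + pi / d < \<zeta> j" if "j \<ge> 1" for j
  proof -
    have "1 * pi / d \<le> real j * pi / d"
      using that d by (intro divide_right_mono mult_right_mono) auto
    then show ?thesis using \<zeta>(1)[of j] by linarith
  qed
  ultimately have cardA: "card A > 2 * D"
  proof -
    have "{x1, x2, x3} \<inter> \<zeta> ` {1..<2 * D} = {}"
      using \<zeta>_ge x1 x2 x3 by fastforce
    then have "card A = card {x1, x2, x3} + card (\<zeta> ` {1..<2 * D})"
      unfolding A_def by (intro card_Un_disjoint) auto
    moreover have "card {x1, x2, x3} = 3" using x1 x2 x3 by auto
    ultimately show ?thesis using D \<open>card (\<zeta> ` {1..<2 * D}) = 2 * D - 1\<close> by linarith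
  qed
  have finA: "finite A" by (simp add: A_def)
  have gA: "g x = 0" if "x \<in> A" for x using that x1 x2 x3 \<zeta> by (auto simp: A_def)
  have A_range: "p < x \<and> x < p + 2 * pi" if "x \<in> A" for x
  proof -
    have "pi / d \<le> 2 * pi" using d by (simp add: field_simps)
    moreover have "\<zeta> j < p + 2 * pi" if "j < 2 * D" for j
    proof -
      have "real (Suc j) * pi / d \<le> real (2 * D) * pi / d"
        using that d by (intro divide_right_mono mult_right_mono) auto
      also have "\<dots> = 2 * pi" using d by (simp add: d_def)
      finally show ?thesis using \<zeta>(2)[of j] by linarith
    qed
    moreover have "pi / d > 0" using d by simp
    ultimately show ?thesis using that x1 x2 x3 \<zeta>_ge by (fastforce simp: A_def)
  qed
  have F_zero: "F (cos y) \<noteq> l * cos (d * y) * cos \<beta>" if "sin (d * y) = 0" for y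
  proof
    assume eq: "F (cos y) = l * cos (d * y) * cos \<beta>"
    from that obtain i :: int where "d * y = of_int i * pi" by (auto simp: sin_zero_iff_int2)
    then have y: "y = of_int i * pi / d" using d by (simp add: field_simps)
    have "cos (d * y) = 1 \<or> cos (d * y) = -1" using that sin_zero_abs_cos_one by fastforce
    then have "l = F (cos y) / cos \<beta> \<or> l = - F (cos y) / cos \<beta>"
      using eq \<beta> by (auto simp: field_simps)
    then show False using l_gen y by blast
  qed
  have sin_ne: "sin (d * y) \<noteq> 0" if "g y = 0" for y
    using F_zero[of y] that by (auto simp: g_def cos_diff)
  \<comment> \<open>An open period contains no two angles that differ by a multiple of
    \<open>2 * pi\<close>, so distinct zeros with equal cosines are reflections of each other modulo
    a period. Subtracting their equations then leaves
    \<open>sin (d * y) * sin \<beta> = 0\<close>.\<close>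
  have inj: "inj_on cos A"
  proof (rule inj_onI, rule ccontr)
    fix x y assume xy: "x \<in> A" "y \<in> A" "cos x = cos y" "x \<noteq> y"
    then obtain n where n: "n \<in> \<int>" "x = y + 2 * n * pi \<or> x = - y + 2 * n * pi"
      by (auto simp: cos_eq)
    then obtain i :: int where i: "n = of_int i" by (auto elim: Ints_cases)
    have "x \<noteq> y + 2 * n * pi"
    proof
      assume *: "x = y + 2 * n * pi"
      then have "\<bar>2 * n * pi\<bar> < 2 * pi" using A_range[OF xy(1)] A_range[OF xy(2)] by linarith
      then have "\<bar>n\<bar> < 1" by (simp add: abs_mult)
      then have "n = 0" using i by auto
      then show False using * xy by simp
    qed
    then have x: "x = - y + 2 * n * pi" using n by blast
    have "d * x - \<beta> = 2 * pi * of_int (int D * i) - (d * y + \<beta>)"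
      unfolding x i d_def by (simp add: algebra_simps)
    then have "cos (d * x - \<beta>) = cos (d * y + \<beta>)"
      by (simp only: cos_diff cos_int_2pin sin_int_2pin)
    moreover have "l * cos (d * x - \<beta>) = l * cos (d * y - \<beta>)"
      using gA[OF xy(1)] gA[OF xy(2)] xy(3) by (simp add: g_def)
    ultimately have "sin (d * y) * sin \<beta> = 0" using l(1) by (simp add: cos_diff cos_add)
    then show False using sin_ne[OF gA[OF xy(2)]] \<beta> by simp
  qed
  \<comment> \<open>The second factor on the right is \<open>g (- y)\<close>, as cosine is
    even.\<close>
  have H: "(F (cos y))\<^sup>2 - 2 * l * cos \<beta> * F (cos y) * Q (cos y) + l\<^sup>2 * ((Q (cos y))\<^sup>2 - (sin \<beta>)\<^sup>2)
      = g y * (F (cos y) - l * cos (d * y + \<beta>))" for y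
  proof -
    have e1: "cos (d * y - \<beta>) * cos (d * y + \<beta>) = (cos (d * y))\<^sup>2 - (sin \<beta>)\<^sup>2"
    proof -
      have "(cos (d * y) * cos \<beta>)\<^sup>2 - (sin (d * y) * sin \<beta>)\<^sup>2 = (cos (d * y))\<^sup>2 - (sin \<beta>)\<^sup>2"
        by (simp add: power_mult_distrib cos_squared_eq algebra_simps)
      then show ?thesis by (simp add: cos_diff cos_add power2_eq_square algebra_simps)
    qed
    have e2: "cos (d * y - \<beta>) + cos (d * y + \<beta>) = 2 * cos (d * y) * cos \<beta>"
      by (simp add: cos_diff cos_add)
    have e3: "g y * (F (cos y) - l * cos (d * y + \<beta>)) =
      (F (cos y))\<^sup>2 - l * F (cos y) * (cos (d * y - \<beta>) + cos (d * y + \<beta>)) + l\<^sup>2 * (cos (d * y - \<beta>) * cos (d * y + \<beta>))"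
      by (simp add: g_def power2_eq_square algebra_simps)
    show ?thesis unfolding e3 e1 e2 by (simp add: Q d_def algebra_simps)
  qed
  \<comment> \<open>A zero with cosine 1 or -1 is a multiple of \<open>pi\<close>, where
    \<open>sin (d * x)\<close> vanishes because \<open>d\<close> is an integer.\<close>
  have "cos ` A \<subseteq> {-1<..<1}"
  proof
    fix u assume "u \<in> cos ` A"
    then obtain x where x: "x \<in> A" "u = cos x" by blast
    have "sin x \<noteq> 0"
    proof
      assume "sin x = 0"
      then obtain i :: int where "x = of_int i * pi" by (auto simp: sin_zero_iff_int2)
      then have "d * x = of_int (int D * i) * pi" by (simp add: d_def)
      then have "sin (d * x) = 0" unfolding sin_zero_iff_int2 by blast
      then show False using sin_ne gA x by blast
    qed
    then have "\<bar>u\<bar> \<noteq> 1" using x(2) sin_zero_abs_cos_one[of x] sin_cos_squared_add[of x]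
      by (metis power2_abs add_cancel_left_left one_power2 power_eq_0_iff add.commute)
    moreover have "\<bar>u\<bar> \<le> 1" using x by simp
    ultimately show "u \<in> {-1<..<1}" by auto
  qed
  moreover have "card (cos ` A) > 2 * D" using cardA inj by (simp add: card_image)
  moreover have "\<forall>u\<in>cos ` A. (F u)\<^sup>2 - 2 * l * cos \<beta> * F u * Q u + l\<^sup>2 * ((Q u)\<^sup>2 - (sin \<beta>)\<^sup>2) = 0"
    using H gA by simp
  ultimately have "\<forall>u\<in>{-1..1}. (F u)\<^sup>2 - 2 * l * cos \<beta> * F u * Q u + l\<^sup>2 * ((Q u)\<^sup>2 - (sin \<beta>)\<^sup>2) = 0"
    using zb finA unfolding zero_bound_def by blast
  \<comment> \<open>At angle 0 both factors of the product coincide, and the choice of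
    \<open>l\<close> makes them nonzero.\<close>
  then have "(F (cos 0))\<^sup>2 - 2 * l * cos \<beta> * F (cos 0) * Q (cos 0) + l\<^sup>2 * ((Q (cos 0))\<^sup>2 - (sin \<beta>)\<^sup>2) = 0"
    by simp
  then have "F (cos 0) = l * cos \<beta>" unfolding H by (auto simp: g_def)
  then show False using F_zero[of 0] by simp
qed

text \<open>The left side reduces to the right by the reflection \<theta> \<mapsto> -\<theta>, which
  changes neither \<open>F (cos \<theta>)\<close> nor the comparison cosine.\<close>

lemma comparison:
  fixes F Q :: "real \<Rightarrow> real" and D :: nat
  assumes "D \<ge> 1" "continuous_on {-1..1} F"
    and "\<And>u. u \<in> {-1..1} \<Longrightarrow> \<bar>F u\<bar> \<le> 1"
    and "\<And>\<theta>. Q (cos \<theta>) = cos (real D * \<theta>)"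
    and "zero_bound D F Q"
    and max: "F (cos \<theta>\<^sub>0) = 1"
    and \<theta>\<^sub>1: "\<bar>\<theta>\<^sub>1 - \<theta>\<^sub>0\<bar> < pi / real D"
  shows "cos (real D * (\<theta>\<^sub>1 - \<theta>\<^sub>0)) \<le> F (cos \<theta>\<^sub>1)"
proof -
  consider "\<theta>\<^sub>0 < \<theta>\<^sub>1" | "\<theta>\<^sub>0 = \<theta>\<^sub>1" | "-\<theta>\<^sub>0 < -\<theta>\<^sub>1" by linarith
  then show ?thesis
  proof cases
    case 1
    then show ?thesis using comparison_pos[OF assms(1-6), of \<theta>\<^sub>1] \<theta>\<^sub>1 by simp
  next
    case 2
    then show ?thesis using max by simp
  next
    case 3
    have "cos (real D * (- \<theta>\<^sub>1 - - \<theta>\<^sub>0)) = cos (real D * (\<theta>\<^sub>1 - \<theta>\<^sub>0))"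
      using cos_minus[of "real D * (\<theta>\<^sub>1 - \<theta>\<^sub>0)"] by (simp add: algebra_simps)
    then show ?thesis
      using comparison_pos[OF assms(1-5), of "-\<theta>\<^sub>0" "-\<theta>\<^sub>1"] max \<theta>\<^sub>1 3 by simp
  qed
qed

section \<open>Chebyshev nodes\<close>

text \<open>On the scale \<open>x = \<theta> * N / pi\<close> the angles of the extrema are integers
  and those of the zeros are half-integers, so rounding costs at most 1/2.\<close>

lemma ex_cheb_node:
  assumes N: "N \<ge> 1" and \<theta>: "0 \<le> \<theta>" "\<theta> \<le> pi"
    and T: "T = cheb_zeros N \<or> T = cheb_extrema N"
  obtains \<tau> where "cos \<tau> \<in> T" "\<bar>\<tau> - \<theta>\<bar> \<le> pi / (2 * real N)"
proof -
  define x where "x = \<theta> * real N / pi"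
  have x: "0 \<le> x" "x \<le> real N" using \<theta> mult_right_mono[of \<theta> pi "real N"] by (auto simp: x_def field_simps)
  have \<theta>x: "\<theta> = x * pi / real N" using N by (simp add: x_def)
  have *: "\<bar>y * pi / real N - \<theta>\<bar> \<le> pi / (2 * real N)" if "\<bar>y - x\<bar> \<le> 1 / 2" for y
  proof -
    have "y * pi / real N - \<theta> = (y - x) * (pi / real N)"
      by (simp add: \<theta>x diff_divide_distrib algebra_simps)
    then have "\<bar>y * pi / real N - \<theta>\<bar> = \<bar>y - x\<bar> * (pi / real N)" by (simp add: abs_mult)
    also have "\<dots> \<le> 1 / 2 * (pi / real N)" using that by (intro mult_right_mono) auto
    finally show ?thesis by simp
  qed
  show ?thesis
  proof (cases "T = cheb_zeros N")
    case True
    \<comment> \<open>The maximum with 1 covers \<open>x = 0\<close>, whose ceiling 0 is not the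
      index of a zero.\<close>
    define i where "i = max 1 (nat \<lceil>x\<rceil>)"
    have "\<lceil>x\<rceil> \<le> int N" using x(2) by (simp add: ceiling_le_iff)
    then have i: "i \<in> {1..N}" using N x(2) by (auto simp: i_def ceiling_le_iff)
    have i': "\<bar>(real i - 1 / 2) - x\<bar> \<le> 1 / 2"
    proof (cases "x = 0")
      case True
      then show ?thesis by (simp add: i_def)
    next
      case False
      then have "\<lceil>x\<rceil> \<ge> 1" using x(1) by (simp add: one_le_ceiling)
      moreover have "real (max 1 (nat c)) = of_int c" if "1 \<le> c" for c :: int
        using that by (auto simp: max_def)
      ultimately have "real i = of_int \<lceil>x\<rceil>" unfolding i_def by blast
      then show ?thesis unfolding abs_le_iff using ceiling_correct[of x] by linarith
    qed
    have "(real i - 1 / 2) * pi / real N = (2 * real i - 1) * pi / (2 * real N)"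
      using N by (simp add: field_simps)
    then have "cos ((real i - 1 / 2) * pi / real N) \<in> T"
      using i True by (auto simp: cheb_zeros_def)
    then show ?thesis using that *[OF i'] by blast
  next
    case False
    define i where "i = nat (round x)"
    have "round x \<le> int N" using x(2) round_mono[of x "real N"] by simp
    moreover have "round x \<ge> 0" using x(1) round_mono[of 0 x] by simp
    ultimately have i: "i \<in> {0..N}" "real i = of_int (round x)" by (auto simp: i_def)
    have "cos (real i * pi / real N) \<in> T"
      using i(1) False T by (auto simp: cheb_extrema_def)
    moreover have "\<bar>real i - x\<bar> \<le> 1 / 2" using of_int_round_abs_le[of x] i(2) by simp
    ultimately show ?thesis using that *[of "real i"] by blast
  qed
qed

lemma cheb_nodes_subset: "T = cheb_zeros N \<or> T = cheb_extrema N \<Longrightarrow> T \<subseteq> {-1..1}"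
  by (auto simp: cheb_zeros_def cheb_extrema_def)

lemma cos_mesh_pos:
  assumes "(m::real) > 1"
  shows "0 < cos (pi / (2 * m))"
proof -
  have "pi / (2 * m) < pi / 2" using assms by (simp add: field_simps)
  then show ?thesis using assms by (intro cos_gt_zero) auto
qed

text \<open>The cosine comparison is applied at a maximum point of the modulus of \<open>h\<close>.
  At a nearest node the phase has moved by at most \<open>D * pi / (2 * N) = pi / (2 * m)\<close>.
  The zero bound is required for every \<open>c\<close> because the rotation depends on the maximum
  point.\<close>

lemma norming_cheb_nodes:
  fixes h :: "real \<Rightarrow> complex"
  assumes D: "D \<ge> 1" and m: "m > 1" and N: "real N = m * real D"
    and T: "T = cheb_zeros N \<or> T = cheb_extrema N"
    and cont: "continuous_on {-1..1} h"
    and Q: "\<And>\<theta>. Q (cos \<theta>) = cos (real D * \<theta>)"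
    and zb: "\<And>c. zero_bound D (\<lambda>u. Re (c * h u)) Q"
    and u: "u \<in> {-1..1}"
  obtains v where "v \<in> T" "cmod (h u) \<le> cheb_const m * cmod (h v)"
proof -
  have c0: "0 < cos (pi / (2 * m))" using cos_mesh_pos m .
  have N1: "N \<ge> 1" using N D m
    by (metis One_nat_def Suc_leI mult_pos_pos of_nat_0_less_iff order_less_le_trans zero_less_one less_trans)
  have "continuous_on {-1..1} (\<lambda>u. cmod (h u))" by (intro continuous_intros cont)
  then obtain u0 where u0: "u0 \<in> {-1..1}" "\<And>u. u \<in> {-1..1} \<Longrightarrow> cmod (h u) \<le> cmod (h u0)"
    using continuous_attains_sup[of "{-1..1::real}" "\<lambda>u. cmod (h u)"] by auto
  define R where "R = cmod (h u0)"
  define \<theta> where "\<theta> = arccos u0"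
  have \<theta>: "0 \<le> \<theta>" "\<theta> \<le> pi" "cos \<theta> = u0"
    using u0(1) by (auto simp: \<theta>_def arccos_lbound arccos_ubound cos_arccos)
  obtain \<tau> where \<tau>: "cos \<tau> \<in> T" "\<bar>\<tau> - \<theta>\<bar> \<le> pi / (2 * real N)"
    using ex_cheb_node[OF N1 \<theta>(1,2) T] by blast
  have "R \<le> cheb_const m * cmod (h (cos \<tau>))"
  proof (cases "R = 0")
    case True
    then show ?thesis using c0 by (simp add: cheb_const_def)
  next
    case False
    then have R: "R > 0" by (simp add: R_def)
    \<comment> \<open>This factor gives \<open>c * h u0 = 1\<close>; since \<open>R\<close> is the
      maximum modulus, the real part \<open>F\<close> stays between -1 and 1.\<close>
    define c where "c = cnj (h u0) / of_real (R\<^sup>2)"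
    have cR: "cmod c = 1 / R" using R by (simp add: c_def norm_divide norm_mult R_def power2_eq_square)
    define F where "F = (\<lambda>u. Re (c * h u))"
    have F_le: "\<bar>F u\<bar> \<le> cmod (h u) / R" for u
      using abs_Re_le_cmod[of "c * h u"] by (simp add: F_def norm_mult cR)
    have "c * h u0 = 1"
    proof -
      have "cnj (h u0) * h u0 = of_real (R\<^sup>2)"
        using complex_norm_square[of "h u0"] by (simp only: R_def mult.commute)
      then show ?thesis using R by (simp add: c_def)
    qed
    then have "F (cos \<theta>) = 1" by (simp only: F_def \<theta> one_complex.sel)
    moreover have "continuous_on {-1..1} F" unfolding F_def by (intro continuous_intros cont)
    moreover have "\<bar>F u\<bar> \<le> 1" if "u \<in> {-1..1}" for u
      using F_le[of u] u0(2)[OF that] R divide_le_eq_1_pos[of R "cmod (h u)"] unfolding R_def by linarith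
    moreover have small: "real D * \<bar>\<tau> - \<theta>\<bar> \<le> pi / (2 * m)"
    proof -
      have "real D * \<bar>\<tau> - \<theta>\<bar> \<le> real D * (pi / (2 * real N))"
        using \<tau>(2) by (intro mult_left_mono) auto
      also have "\<dots> = pi / (2 * m)" using D m by (simp add: N)
      finally show ?thesis .
    qed
    moreover have "\<bar>\<tau> - \<theta>\<bar> < pi / real D"
    proof -
      have "pi / (2 * m) < pi" using m by (simp add: field_simps)
      then show ?thesis using small D by (simp add: field_simps)
    qed
    ultimately have "cos (real D * (\<tau> - \<theta>)) \<le> F (cos \<tau>)"
      using comparison[OF D, of F Q \<theta> \<tau>] Q zb[of c] by (simp add: F_def)
    moreover have "cos (pi / (2 * m)) \<le> cos (real D * (\<tau> - \<theta>))"
    proof -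
      have "pi / (2 * m) \<le> pi" using m by (simp add: field_simps)
      then have "cos (pi / (2 * m)) \<le> cos \<bar>real D * (\<tau> - \<theta>)\<bar>"
        using small by (intro cos_monotone_0_pi_le) (auto simp: abs_mult)
      then show ?thesis by simp
    qed
    ultimately have "cos (pi / (2 * m)) \<le> cmod (h (cos \<tau>)) / R" using F_le[of "cos \<tau>"] by linarith
    then show ?thesis using R c0 by (simp add: cheb_const_def field_simps)
  qed
  then show ?thesis using that \<tau>(1) u0(2)[OF u] by (auto simp: R_def)
qed

section \<open>Algebraic and trigonometric polynomials\<close>

text \<open>These are the Chebyshev polynomials of the first kind, from the recurrence T_{n+2} = 2 x
  T_{n+1} - T_n.\<close>

lemma ex_chebyshev_poly:
  "\<exists>p :: real poly. degree p \<le> D \<and> (\<forall>\<theta>. poly p (cos \<theta>) = cos (real D * \<theta>))"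
proof (induction D rule: less_induct)
  case (less D)
  consider "D = 0" | "D = 1" | n where "D = Suc (Suc n)" by (metis One_nat_def nat.exhaust)
  then show ?case
  proof cases
    case 1
    then show ?thesis by (intro exI[of _ 1]) auto
  next
    case 2
    then show ?thesis by (intro exI[of _ "[:0, 1:]"]) auto
  next
    case (3 n)
    obtain p q :: "real poly" where p: "degree p \<le> Suc n" "\<And>\<theta>. poly p (cos \<theta>) = cos (real (Suc n) * \<theta>)"
      and q: "degree q \<le> n" "\<And>\<theta>. poly q (cos \<theta>) = cos (real n * \<theta>)"
      using less.IH[of "Suc n"] less.IH[of n] 3 by (metis lessI less_SucI)
    have "degree ([:0, 2:] * p - q) \<le> D"
      using degree_mult_le[of "[:0, 2:]" p] p(1) q(1) 3 by (intro degree_diff_le) auto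
    moreover have "poly ([:0, 2:] * p - q) (cos \<theta>) = cos (real D * \<theta>)" for \<theta>
    proof -
      have "2 * cos (real (Suc n) * \<theta>) * cos \<theta> =
          cos (real (Suc n) * \<theta> - \<theta>) + cos (real (Suc n) * \<theta> + \<theta>)"
        by (simp add: cos_diff cos_add)
      then show ?thesis using 3 by (simp add: p q algebra_simps)
    qed
    ultimately show ?thesis by blast
  qed
qed

text \<open>The tested expression is a polynomial of degree at most \<open>2 * D\<close>, so more
  than \<open>2 * D\<close> zeros annihilate it.\<close>

lemma zero_bound_algebraic:
  fixes f q :: "real poly"
  assumes "degree f \<le> D" "degree q \<le> D"
  shows "zero_bound D (poly f) (poly q)"
  unfolding zero_bound_def
proof (intro allI impI ballI)
  fix A B c :: real and X :: "real set" and u :: real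
  assume X: "X \<subseteq> {-1<..<1}" "finite X" "2 * D < card X"
    and zero: "\<forall>u\<in>X. (poly f u)\<^sup>2 - A * poly f u * poly q u + B * ((poly q u)\<^sup>2 - c) = 0"
  define H where "H = f\<^sup>2 - smult A (f * q) + smult B (q\<^sup>2 - [:c:])"
  have H: "poly H u = (poly f u)\<^sup>2 - A * poly f u * poly q u + B * ((poly q u)\<^sup>2 - c)" for u
    by (simp add: H_def)
  have d1: "degree (f\<^sup>2) \<le> 2 * D" "degree (q\<^sup>2) \<le> 2 * D" "degree (f * q) \<le> 2 * D"
    using assms degree_power_le[of f 2] degree_power_le[of q 2] degree_mult_le[of f q] by auto
  then have "degree H \<le> 2 * D"
    unfolding H_def by (intro degree_add_le degree_diff_le order.trans[OF degree_smult_le]) auto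
  moreover have "card X \<le> degree H" if "H \<noteq> 0"
  proof -
    have "card X \<le> card {u. poly H u = 0}"
      using that zero H by (intro card_mono poly_roots_finite) auto
    then show ?thesis using card_poly_roots_bound[OF that] by linarith
  qed
  ultimately have "H = 0" using X(3) by linarith
  then show "(poly f u)\<^sup>2 - A * poly f u * poly q u + B * ((poly q u)\<^sup>2 - c) = 0"
    using H[of u] by simp
qed

lemma Re_poly_of_real: "Re (poly p (of_real x)) = poly (map_poly Re p) x"
  by (induction p) (auto simp: map_poly_pCons)

text \<open>Trigonometric polynomials of degree at most \<open>d\<close> are the Laurent polynomials
  in \<open>cis t\<close> with exponents from \<open>-d\<close> to \<open>d\<close>. The factor
  \<open>cis t ^ d\<close> clears negative powers, so counting zeros becomes counting roots of
  \<open>q\<close>.\<close>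

definition trig_fun :: "nat \<Rightarrow> (real \<Rightarrow> complex) \<Rightarrow> bool" where
  "trig_fun d f \<longleftrightarrow> (\<exists>q. degree q \<le> 2 * d \<and> (\<forall>t. f t * cis t ^ d = poly q (cis t)))"

lemma trig_funI: "degree q \<le> 2 * d \<Longrightarrow> (\<And>t. f t * cis t ^ d = poly q (cis t)) \<Longrightarrow> trig_fun d f"
  by (auto simp: trig_fun_def)

lemma trig_fun_const: "trig_fun d (\<lambda>_. c)"
  by (rule trig_funI[of "monom c d"]) (auto simp: poly_monom intro: order.trans[OF degree_monom_le])

lemma trig_fun_mult:
  assumes "trig_fun d f" "trig_fun e g"
  shows "trig_fun (d + e) (\<lambda>t. f t * g t)"
proof -
  obtain p q where "degree p \<le> 2 * d" "\<And>t. f t * cis t ^ d = poly p (cis t)"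
    "degree q \<le> 2 * e" "\<And>t. g t * cis t ^ e = poly q (cis t)"
    using assms by (auto simp: trig_fun_def)
  moreover have "f t * g t * cis t ^ (d + e) = (f t * cis t ^ d) * (g t * cis t ^ e)" for t
    by (simp add: power_add)
  ultimately show ?thesis
    using degree_mult_le[of p q] by (intro trig_funI[of "p * q"]) auto
qed

lemma trig_fun_cmult: "trig_fun d f \<Longrightarrow> trig_fun d (\<lambda>t. c * f t)"
  using trig_fun_mult[OF trig_fun_const[of 0 c], of d f] by simp

lemma trig_fun_add:
  assumes "trig_fun d f" "trig_fun d g"
  shows "trig_fun d (\<lambda>t. f t + g t)"
proof -
  obtain p q where "degree p \<le> 2 * d" "\<And>t. f t * cis t ^ d = poly p (cis t)"
    "degree q \<le> 2 * d" "\<And>t. g t * cis t ^ d = poly q (cis t)"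
    using assms by (auto simp: trig_fun_def)
  then show ?thesis
    by (intro trig_funI[of "p + q"]) (auto simp: distrib_right intro: degree_add_le)
qed

lemma trig_fun_diff:
  assumes "trig_fun d f" "trig_fun d g"
  shows "trig_fun d (\<lambda>t. f t - g t)"
  using trig_fun_add[OF assms(1) trig_fun_cmult[OF assms(2), of "-1"]] by simp

lemma trig_fun_sum:
  assumes "\<And>i. i \<in> I \<Longrightarrow> trig_fun d (f i)"
  shows "trig_fun d (\<lambda>t. \<Sum>i\<in>I. f i t)"
  using assms
  by (induction I rule: infinite_finite_induct) (auto intro: trig_fun_const trig_fun_add)

lemma trig_fun_mono:
  assumes "trig_fun d f" "d \<le> e"
  shows "trig_fun e f"
  using trig_fun_mult[OF trig_fun_const[of "e - d" 1] assms(1)] assms(2) by simp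

lemma trig_fun_power:
  assumes "trig_fun d f"
  shows "trig_fun (n * d) (\<lambda>t. f t ^ n)"
  using assms by (induction n) (auto intro: trig_fun_const trig_fun_mult)

lemma trig_fun_poly:
  assumes "trig_fun d f" "degree p \<le> n"
  shows "trig_fun (n * d) (\<lambda>t. poly p (f t))"
  unfolding poly_altdef
proof (rule trig_fun_sum)
  fix i assume "i \<in> {..degree p}"
  then have "i * d \<le> n * d" using assms(2) by simp
  then show "trig_fun (n * d) (\<lambda>t. coeff p i * f t ^ i)"
    using trig_fun_mono trig_fun_cmult trig_fun_power[OF assms(1)] by blast
qed

lemma trig_fun_cnj:
  assumes "trig_fun d f"
  shows "trig_fun d (\<lambda>t. cnj (f t))"
proof -
  obtain q where q: "degree q \<le> 2 * d" "\<And>t. f t * cis t ^ d = poly q (cis t)"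
    using assms by (auto simp: trig_fun_def)
  \<comment> \<open>On the unit circle \<open>cnj (cis t)\<close> is the inverse of
    \<open>cis t\<close>, so conjugation reverses the coefficients. The reversal is about
    \<open>2 * d\<close> rather than the degree of \<open>q\<close>, to fit the factor
    \<open>cis t ^ d\<close>.\<close>
  define r where "r = (\<Sum>i\<le>2 * d. monom (cnj (coeff q i)) (2 * d - i))"
  have "degree r \<le> 2 * d"
    unfolding r_def by (intro degree_sum_le) (auto intro: order.trans[OF degree_monom_le])
  moreover have "cnj (f t) * cis t ^ d = poly r (cis t)" for t
  proof -
    have q': "poly q x = (\<Sum>i\<le>2 * d. coeff q i * x ^ i)" for x
      unfolding poly_altdef using q(1) by (intro sum.mono_neutral_left) (auto simp: coeff_eq_0)
    have inv: "cnj (cis t) * cis t = 1" by (simp add: cis_cnj cis_mult)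
    have "cnj (f t) * cis t ^ d = cnj (f t) * (cnj (cis t) * cis t) ^ d * cis t ^ d"
      by (simp add: inv)
    also have "\<dots> = cnj (f t * cis t ^ d) * cis t ^ (2 * d)"
      by (simp add: power_mult_distrib power_add mult_2)
    also have "\<dots> = (\<Sum>i\<le>2 * d. cnj (coeff q i) * (cnj (cis t) ^ i * cis t ^ (2 * d)))"
      by (simp add: q(2) q' sum_distrib_right mult.assoc)
    also have "\<dots> = (\<Sum>i\<le>2 * d. cnj (coeff q i) * cis t ^ (2 * d - i))"
    proof (rule sum.cong)
      fix i assume "i \<in> {..2 * d}"
      then have "cis t ^ (2 * d) = cis t ^ i * cis t ^ (2 * d - i)" by (simp flip: power_add)
      then have "cnj (cis t) ^ i * cis t ^ (2 * d) = (cnj (cis t) * cis t) ^ i * cis t ^ (2 * d - i)"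
        by (simp add: power_mult_distrib)
      then show "cnj (coeff q i) * (cnj (cis t) ^ i * cis t ^ (2 * d)) = cnj (coeff q i) * cis t ^ (2 * d - i)"
        by (simp add: inv)
    qed simp
    also have "\<dots> = poly r (cis t)" by (simp add: r_def poly_sum poly_monom)
    finally show ?thesis .
  qed
  ultimately show ?thesis by (rule trig_funI)
qed

lemma trig_fun_cis: "trig_fun j (\<lambda>t. cis (real j * t))"
  by (rule trig_funI[of "monom 1 (2 * j)"])
    (auto simp: poly_monom Complex.DeMoivre mult_2 power_add intro: order.trans[OF degree_monom_le])

lemma trig_fun_Re:
  assumes "trig_fun d f"
  shows "trig_fun d (\<lambda>t. of_real (Re (f t)))"
proof -
  have "complex_of_real (Re x) = 1 / 2 * (x + cnj x)" for x by (simp add: complex_add_cnj)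
  then show ?thesis
    by (simp only:) (intro trig_fun_cmult trig_fun_add trig_fun_cnj assms)
qed

lemma trig_fun_cos: "trig_fun j (\<lambda>t. of_real (cos (real j * t)))"
  using trig_fun_Re[OF trig_fun_cis[of j]] by simp

lemma trig_fun_sin: "trig_fun j (\<lambda>t. of_real (sin (real j * t)))"
  using trig_fun_Re[OF trig_fun_cmult[OF trig_fun_cis[of j], of "- \<i>"]] by simp

lemma trig_fun_shift:
  assumes "trig_fun d f"
  shows "trig_fun d (\<lambda>t. f (t + s))"
proof -
  obtain q where q: "degree q \<le> 2 * d" "\<And>t. f t * cis t ^ d = poly q (cis t)"
    using assms by (auto simp: trig_fun_def)
  have inv: "cis (- s) * cis s = 1" by (simp add: cis_mult)
  show ?thesis
  proof (rule trig_funI)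
    show "degree (smult (cis (- s) ^ d) (q \<circ>\<^sub>p [:0, cis s:])) \<le> 2 * d"
      using q(1) by (simp add: degree_pcompose)
  next
    fix t
    have "f (t + s) * cis t ^ d = f (t + s) * (cis (- s) * cis s) ^ d * cis t ^ d" by (simp add: inv)
    also have "\<dots> = cis (- s) ^ d * (f (t + s) * cis (t + s) ^ d)"
      by (simp add: power_mult_distrib flip: cis_mult)
    also have "\<dots> = cis (- s) ^ d * poly q (cis (t + s))" by (simp add: q)
    finally show "f (t + s) * cis t ^ d = poly (smult (cis (- s) ^ d) (q \<circ>\<^sub>p [:0, cis s:])) (cis t)"
      by (simp add: poly_pcompose cis_mult ac_simps)
  qed
qed

text \<open>On an open period \<open>cis\<close> is injective, so zeros of \<open>f\<close> become
  distinct roots of a polynomial of degree at most \<open>2 * d\<close>.\<close>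

lemma trig_fun_zeros:
  assumes f: "trig_fun d f" and X: "X \<subseteq> {-pi<..<pi}" "finite X" "card X > 2 * d"
    and zero: "\<And>t. t \<in> X \<Longrightarrow> f t = 0"
  shows "f t = 0"
proof -
  obtain q where q: "degree q \<le> 2 * d" "\<And>t. f t * cis t ^ d = poly q (cis t)"
    using f by (auto simp: trig_fun_def)
  have "inj_on cis X"
  proof (rule inj_on_inverseI)
    fix t assume "t \<in> X"
    then show "Arg (cis t) = t" using X(1) by (intro Arg_cis) force
  qed
  then have "card (cis ` X) > 2 * d" using X(3) by (simp add: card_image)
  moreover have "card (cis ` X) \<le> degree q" if "q \<noteq> 0"
  proof -
    have "card (cis ` X) \<le> card {w. poly q w = 0}"
      using that zero by (intro card_mono poly_roots_finite) (auto simp flip: q(2))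
    then show ?thesis using card_poly_roots_bound[OF that] by linarith
  qed
  ultimately have "q = 0" using q(1) by linarith
  then show ?thesis using q(2)[of t] by simp
qed

text \<open>In the variable \<open>t = 2 * arcsin (u * S)\<close> the tested expression is a
  trigonometric polynomial of degree at most \<open>2 * d\<close>, with at most \<open>4 * d\<close>
  zeros in an open period unless it vanishes. The substitution sends the open interval injectively
  into such a period.\<close>

lemma zero_bound_trigonometric:
  fixes f g :: "real \<Rightarrow> real"
  assumes f: "trig_fun d (\<lambda>t. of_real (f t))" and g: "trig_fun d (\<lambda>t. of_real (g t))"
    and S: "0 < S" "S \<le> 1"
  shows "zero_bound (2 * d) (\<lambda>u. f (2 * arcsin (u * S))) (\<lambda>u. g (2 * arcsin (u * S)))"
  unfolding zero_bound_def
proof (intro allI impI ballI)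
  fix A B c :: real and X :: "real set" and u :: real
  define H where "H = (\<lambda>t. (f t)\<^sup>2 - A * f t * g t + B * ((g t)\<^sup>2 - c))"
  define \<tau> where "\<tau> = (\<lambda>u. 2 * arcsin (u * S))"
  assume X: "X \<subseteq> {-1<..<1}" "finite X" "2 * (2 * d) < card X"
    and zero: "\<forall>u\<in>X. (f (2 * arcsin (u * S)))\<^sup>2 - A * f (2 * arcsin (u * S)) * g (2 * arcsin (u * S))
      + B * ((g (2 * arcsin (u * S)))\<^sup>2 - c) = 0"
  have "trig_fun (d + d) (\<lambda>t. of_real (f t) * of_real (f t)
      - of_real A * (of_real (f t) * of_real (g t))
      + of_real B * (of_real (g t) * of_real (g t) - of_real c))"
    by (intro trig_fun_add trig_fun_diff trig_fun_cmult trig_fun_mult trig_fun_const f g)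
  then have H: "trig_fun (2 * d) (\<lambda>t. of_real (H t))"
    by (simp add: H_def power2_eq_square mult.assoc flip: mult_2)
  have XS: "-1 < u * S \<and> u * S < 1" if "u \<in> X" for u
  proof -
    have "\<bar>u\<bar> < 1" using that X(1) by (auto simp: abs_less_iff)
    then have "\<bar>u\<bar> * S < 1 * 1" using S by (intro mult_less_le_imp_less) auto
    then have "\<bar>u * S\<bar> < 1" using S by (simp add: abs_mult)
    then show ?thesis by (auto simp: abs_less_iff)
  qed
  have "inj_on \<tau> X"
  proof (rule inj_onI)
    fix x y assume xy: "x \<in> X" "y \<in> X" "\<tau> x = \<tau> y"
    then have "sin (arcsin (x * S)) = sin (arcsin (y * S))" by (simp add: \<tau>_def)
    then show "x = y" using XS[OF xy(1)] XS[OF xy(2)] S by simp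
  qed
  moreover have "\<tau> ` X \<subseteq> {-pi<..<pi}"
    using XS arcsin_lt_bounded by (fastforce simp: \<tau>_def)
  moreover have "complex_of_real (H t) = 0" if "t \<in> \<tau> ` X" for t
    using that zero unfolding H_def \<tau>_def of_real_eq_0_iff by auto
  ultimately have "complex_of_real (H (\<tau> u)) = 0"
    using X(2,3) trig_fun_zeros[OF H, of "\<tau> ` X"] by (simp add: card_image)
  then have "H (\<tau> u) = 0" by (simp only: of_real_eq_0_iff)
  then show "(f (2 * arcsin (u * S)))\<^sup>2 - A * f (2 * arcsin (u * S)) * g (2 * arcsin (u * S))
      + B * ((g (2 * arcsin (u * S)))\<^sup>2 - c) = 0"
    by (simp add: H_def \<tau>_def)
qed

lemma trig_fun_trig_poly:
  assumes "is_trig_poly_le z \<nu>"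
  shows "trig_fun \<nu> z"
proof -
  obtain \<alpha> \<beta> where z: "z = (\<lambda>t. \<alpha> 0 +
     (\<Sum>j = 1..\<nu>. \<alpha> j * of_real (cos (real j * t)) + \<beta> j * of_real (sin (real j * t))))"
    using assms unfolding is_trig_poly_le_def by blast
  show ?thesis unfolding z
  proof (intro trig_fun_add trig_fun_const trig_fun_sum)
    fix j assume "j \<in> {1..\<nu>}"
    then have "j \<le> \<nu>" by simp
    then show "trig_fun \<nu> (\<lambda>t. \<alpha> j * of_real (cos (real j * t)))"
      "trig_fun \<nu> (\<lambda>t. \<beta> j * of_real (sin (real j * t)))"
      by (intro trig_fun_cmult trig_fun_mono[OF trig_fun_cos] trig_fun_mono[OF trig_fun_sin]; assumption)+
  qed
qed

lemma continuous_on_trig_poly: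
  assumes "is_trig_poly_le z \<nu>"
  shows "continuous_on A z"
proof -
  obtain \<alpha> \<beta> where z: "z = (\<lambda>t. \<alpha> 0 +
     (\<Sum>j = 1..\<nu>. \<alpha> j * of_real (cos (real j * t)) + \<beta> j * of_real (sin (real j * t))))"
    using assms unfolding is_trig_poly_le_def by blast
  show ?thesis unfolding z by (intro continuous_intros)
qed

section \<open>Norming inequalities\<close>

lemma sin_quarter:
  assumes "a < b" "b - a \<le> 2 * pi"
  shows "0 < sin ((b - a) / 4)" "sin ((b - a) / 4) \<le> 1"
  using assms by (auto intro!: sin_gt_zero)

text \<open>The bound \<open>b - a \<le> 2 * pi\<close> keeps \<open>(b - a) / 4\<close> in the
  range where \<open>arcsin\<close> inverts \<open>sin\<close>; both inclusions then follow by
  monotonicity.\<close>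

lemma cheb_map_trig_image:
  assumes ab: "a < b" "b - a \<le> 2 * pi"
  shows "cheb_map Trigonometric a b ` {-1..1} = {a..b}"
proof -
  define S where "S = sin ((b - a) / 4)"
  have S: "0 < S" "S \<le> 1" using sin_quarter[OF ab] by (auto simp: S_def)
  have arcS: "arcsin S = (b - a) / 4" unfolding S_def using ab by (intro arcsin_sin) auto
  show ?thesis
  proof (intro equalityI subsetI)
    fix t assume "t \<in> cheb_map Trigonometric a b ` {-1..1}"
    then obtain u where u: "-1 \<le> u" "u \<le> 1" "t = 2 * arcsin (u * S) + (b + a) / 2"
      by (auto simp: S_def)
    have uS: "u * S \<le> S" "- S \<le> u * S"
      using u S mult_right_mono[of u 1 S] mult_right_mono[of "-1" u S] by auto
    have "arcsin (u * S) \<le> arcsin S" "arcsin (- S) \<le> arcsin (u * S)"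
      by (rule arcsin_le_arcsin; use uS S in linarith)+
    then have "\<bar>arcsin (u * S)\<bar> \<le> (b - a) / 4" using S arcS arcsin_minus[of S] by linarith
    then show "t \<in> {a..b}" by (auto simp: u(3) abs_le_iff field_simps)
  next
    fix t assume t: "t \<in> {a..b}"
    define x where "x = (t - (b + a) / 2) / 2"
    have x: "- ((b - a) / 4) \<le> x" "x \<le> (b - a) / 4" using t by (auto simp: x_def field_simps)
    have e: "(b - a) / 4 \<le> pi / 2" using ab by simp
    then have e': "- (pi / 2) \<le> - ((b - a) / 4)" by (simp only: neg_le_iff_le)
    have "sin x \<le> S"
      unfolding S_def by (rule sin_monotone_2pi_le[OF order.trans[OF e' x(1)] x(2) e])
    moreover have "sin (- ((b - a) / 4)) \<le> sin x"
      by (rule sin_monotone_2pi_le[OF e' x(1) order.trans[OF x(2) e]])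
    ultimately have "sin x \<le> S" "- S \<le> sin x" by (simp_all add: S_def)
    then have "sin x / S \<in> {-1..1}" using S by (simp add: field_simps)
    moreover have "arcsin (sin x) = x"
      by (rule arcsin_sin[OF order.trans[OF e' x(1)] order.trans[OF x(2) e]])
    then have "cheb_map Trigonometric a b (sin x / S) = t"
      using S by (simp add: x_def S_def[symmetric])
    ultimately show "t \<in> cheb_map Trigonometric a b ` {-1..1}" by (metis image_eqI)
  qed
qed

lemma cheb_map_alg_image:
  assumes "a < b"
  shows "cheb_map Algebraic a b ` {-1..1} = {a..b}"
proof (intro equalityI subsetI)
  fix t assume "t \<in> cheb_map Algebraic a b ` {-1..1}"
  then obtain u where u: "-1 \<le> u" "u \<le> 1" "t = (b - a) / 2 * u + (b + a) / 2" by auto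
  have "(b - a) / 2 * u \<le> (b - a) / 2 * 1" "(b - a) / 2 * (-1) \<le> (b - a) / 2 * u"
    by (rule mult_left_mono; use u assms in simp)+
  moreover have "(b - a) / 2 * 1 + (b + a) / 2 = b" "(b - a) / 2 * (-1) + (b + a) / 2 = a"
    by (simp_all add: field_simps)
  ultimately have "t \<le> b" "a \<le> t" unfolding u(3) by (metis add_right_mono)+
  then show "t \<in> {a..b}" by simp
next
  fix t assume "t \<in> {a..b}"
  then have "(2 * t - (b + a)) / (b - a) \<in> {-1..1}" using assms by (auto simp: field_simps)
  moreover have "cheb_map Algebraic a b ((2 * t - (b + a)) / (b - a)) = t"
    using assms by (simp add: field_simps)
  ultimately show "t \<in> cheb_map Algebraic a b ` {-1..1}" by (metis image_eqI)
qed

lemma cheb_map_image: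
  assumes "a < b" "is_arc_map \<kappa> z k a b"
  shows "cheb_map \<kappa> a b ` {-1..1} = {a..b}"
  using assms cheb_map_alg_image cheb_map_trig_image by (cases \<kappa>) auto

text \<open>Along the arc \<open>p\<close> is a polynomial in \<open>u\<close> of degree at most
  \<open>n * k\<close>, and so is the real part of any multiple of it.\<close>

lemma norming_algebraic:
  assumes "a < b" "is_alg_poly z k" "k \<ge> 1" "n \<ge> 1" "m > 1" "real N = m * real n * real k"
    and T: "T = cheb_zeros N \<or> T = cheb_extrema N"
    and p: "degree p \<le> n" and u: "u \<in> {-1..1}"
  obtains v where "v \<in> T"
    "cmod (poly p (z (cheb_map Algebraic a b u))) \<le> cheb_const m * cmod (poly p (z (cheb_map Algebraic a b v)))"
proof -
  define D where "D = n * k"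
  obtain q where q: "degree q = k" "\<And>t. z t = poly q (of_real t)"
    using assms(2) unfolding is_alg_poly_def by blast
  obtain c :: "real poly" where c: "degree c \<le> D" "\<And>\<theta>. poly c (cos \<theta>) = cos (real D * \<theta>)"
    using ex_chebyshev_poly by blast
  define r where "r = p \<circ>\<^sub>p q \<circ>\<^sub>p [:of_real ((b + a) / 2), of_real ((b - a) / 2):]"
  have r: "poly r (of_real u) = poly p (z (cheb_map Algebraic a b u))" for u
    by (simp add: r_def poly_pcompose q algebra_simps)
  have "degree r \<le> D"
    using p q(1) assms(1) by (simp add: r_def degree_pcompose D_def)
  have zb: "zero_bound D (\<lambda>u. Re (e * poly r (of_real u))) (poly c)" for e
  proof -
    have "(\<lambda>u. Re (e * poly r (of_real u))) = poly (map_poly Re (smult e r))"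
      by (rule ext) (simp flip: Re_poly_of_real)
    moreover have "degree (map_poly Re (smult e r)) \<le> D"
      using \<open>degree r \<le> D\<close> map_poly_degree_leq[of Re "smult e r"] degree_smult_le[of e r] by simp
    ultimately show ?thesis using zero_bound_algebraic c(1) by simp
  qed
  have cont: "continuous_on {-1..1} (\<lambda>u::real. poly r (of_real u))" by (intro continuous_intros)
  have "D \<ge> 1" "real N = m * real D" using assms by (auto simp: D_def)
  then obtain v where "v \<in> T" "cmod (poly r (of_real u)) \<le> cheb_const m * cmod (poly r (of_real v))"
    using norming_cheb_nodes[OF _ \<open>m > 1\<close> _ T cont c(2) zb u] by blast
  then show ?thesis using that r by simp
qed

text \<open>Centred at the midpoint of the interval, \<open>p\<close> along the arc is a
  trigonometric polynomial of degree at most \<open>d = n * k\<close>. The comparison frequency is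
  \<open>2 * d\<close>, which accounts for the factor 2 in \<open>N\<close>.\<close>

lemma norming_trigonometric:
  assumes ab: "a < b" "b - a \<le> 2 * pi" and z: "is_trig_poly_le z k"
    and "k \<ge> 1" "n \<ge> 1" "m > 1" "real N = 2 * m * real n * real k"
    and T: "T = cheb_zeros N \<or> T = cheb_extrema N"
    and p: "degree p \<le> n" and u: "u \<in> {-1..1}"
  obtains v where "v \<in> T"
    "cmod (poly p (z (cheb_map Trigonometric a b u))) \<le> cheb_const m * cmod (poly p (z (cheb_map Trigonometric a b v)))"
proof -
  define d where "d = n * k"
  define S where "S = sin ((b - a) / 4)"
  have S: "0 < S" "S \<le> 1" using sin_quarter[OF ab] by (auto simp: S_def)
  obtain c :: "real poly" where c: "degree c \<le> d" "\<And>\<theta>. poly c (cos \<theta>) = cos (real d * \<theta>)"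
    using ex_chebyshev_poly by blast
  \<comment> \<open>For \<open>t = 2 * arcsin (u * S)\<close> the argument of \<open>c\<close> is
    \<open>2 * u\<^sup>2 - 1\<close>. Thus \<open>g\<close> is the Chebyshev polynomial of degree
    \<open>2 * d\<close> in \<open>u\<close>, yet has degree at most \<open>d\<close> in
    \<open>t\<close>.\<close>
  define g where "g = (\<lambda>t. poly c ((1 - cos t) / S\<^sup>2 - 1))"
  define G where "G = (\<lambda>t. poly p (z (t + (b + a) / 2)))"
  have G: "trig_fun d G"
    unfolding G_def d_def
    by (intro trig_fun_shift trig_fun_poly trig_fun_trig_poly z p)
  have g: "trig_fun d (\<lambda>t. of_real (g t))"
  proof -
    define c' where "c' = map_poly complex_of_real c \<circ>\<^sub>p [:1 / of_real (S\<^sup>2) - 1, - 1 / of_real (S\<^sup>2):]"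
    have "complex_of_real (poly c x) = poly (map_poly complex_of_real c) (of_real x)" for x
      by (induction c) (auto simp: map_poly_pCons)
    then have "complex_of_real (g t) = poly c' (of_real (cos (real 1 * t)))" for t
      by (simp add: g_def c'_def poly_pcompose diff_divide_distrib algebra_simps)
    moreover have "degree c' \<le> d" using c(1) S map_poly_degree_leq[of complex_of_real c]
      by (simp add: c'_def degree_pcompose)
    ultimately show ?thesis using trig_fun_poly[OF trig_fun_cos[of 1], of c' d] by simp
  qed
  have Q: "g (2 * arcsin (cos \<theta> * S)) = cos (real (2 * d) * \<theta>)" for \<theta>
  proof -
    have "\<bar>cos \<theta> * S\<bar> \<le> 1" using S by (simp add: abs_mult mult_le_one)
    then have "sin (arcsin (cos \<theta> * S)) = cos \<theta> * S" by (simp add: abs_le_iff)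
    then have "(1 - cos (2 * arcsin (cos \<theta> * S))) / S\<^sup>2 - 1 = cos (2 * \<theta>)"
      using S cos_double_cos[of \<theta>] cos_double_sin[of "arcsin (cos \<theta> * S)"]
      by (simp add: power_mult_distrib del: sin_arcsin)
    then show ?thesis by (simp add: g_def c(2) mult.assoc mult.left_commute)
  qed
  define h where "h = (\<lambda>u. G (2 * arcsin (u * S)))"
  have "zero_bound (2 * d) (\<lambda>u. Re (e * h u)) (\<lambda>u. g (2 * arcsin (u * S)))" for e
    unfolding h_def
    using zero_bound_trigonometric[of d "\<lambda>t. Re (e * G t)", OF trig_fun_Re[OF trig_fun_cmult[OF G]] g S] .
  moreover have "continuous_on {-1..1} h"
  proof -
    have "\<bar>u * S\<bar> \<le> 1" if "u \<in> {-1..1}" for u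
      using that S by (auto simp: abs_mult abs_le_iff intro!: mult_le_one)
    then have "\<forall>u\<in>{-1..1}. -1 \<le> u * S \<and> u * S \<le> 1" by (auto simp: abs_le_iff)
    then show ?thesis unfolding h_def G_def
      by (intro continuous_intros continuous_on_compose2[OF continuous_on_trig_poly[OF z, of UNIV]]) auto
  qed
  moreover have "2 * d \<ge> 1" "real N = m * real (2 * d)" using assms by (auto simp: d_def)
  ultimately obtain v where "v \<in> T" "cmod (h u) \<le> cheb_const m * cmod (h v)"
    using norming_cheb_nodes[of "2 * d" m N T h "\<lambda>u. g (2 * arcsin (u * S))" u] \<open>m > 1\<close> T Q u by blast
  moreover have "h w = poly p (z (cheb_map Trigonometric a b w))" for w
    by (simp add: h_def G_def S_def)
  ultimately show ?thesis using that by simp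
qed

lemma norming_arc:
  assumes "a < b" "is_arc_map \<kappa> z k a b" "k \<ge> 1" "n \<ge> 1" "m > 1" "real N = num_points \<kappa> m n k"
    and "T = cheb_zeros N \<or> T = cheb_extrema N" "degree p \<le> n" "t \<in> {a..b}"
  obtains v where "v \<in> T" "cmod (poly p (z t)) \<le> cheb_const m * cmod (poly p (z (cheb_map \<kappa> a b v)))"
proof -
  obtain u where u: "u \<in> {-1..1}" "t = cheb_map \<kappa> a b u"
    using cheb_map_image[OF assms(1,2)] assms(9) by (metis imageE)
  show ?thesis
  proof (cases \<kappa>)
    case Algebraic
    then show ?thesis
      using norming_algebraic[of a b z k n m N T p u] assms u that by auto
  next
    case Trigonometric
    then show ?thesis
      using norming_trigonometric[of a b z k n m N T p u] assms u that by (auto simp: is_trig_poly_def)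
  qed
qed

text \<open>The complement of \<open>outside K\<close> is \<open>K\<close> with its holes filled: it
  is bounded, contains \<open>K\<close> and has the outer boundary as its frontier.\<close>

lemma maximum_modulus_outer_boundary:
  assumes K: "compact K" and p: "\<And>w. w \<in> outer_boundary K \<Longrightarrow> cmod (poly p w) \<le> B"
    and w: "w \<in> K"
  shows "cmod (poly p w) \<le> B"
proof (rule maximum_modulus_frontier[where S = "- outside K" and f = "poly p" and \<xi> = w])
  show "bounded (- outside K)"
    using cobounded_outside K compact_imp_bounded by blast
  show "w \<in> - outside K" using w by (simp add: outside_def)
qed (use p in \<open>auto simp: outer_boundary_def frontier_complement intro!: holomorphic_intros continuous_intros\<close>)

section \<open>The operator norm\<close>

lemma compact_imp_bdd_above_norm:
  fixes g :: "'a::topological_space \<Rightarrow> 'b::real_normed_vector"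
  assumes "compact K" "continuous_on K g"
  shows "bdd_above ((\<lambda>w. norm (g w)) ` K)"
  using assms
  by (intro bounded_imp_bdd_above compact_imp_bounded compact_continuous_image continuous_intros)

lemma norm_le_sup_norm:
  assumes "bdd_above ((\<lambda>w. norm (g w)) ` Y)" "w \<in> Y"
  shows "norm (g w) \<le> sup_norm Y g"
  unfolding sup_norm_def using assms by (intro cSUP_upper)

lemma sup_norm_pos:
  fixes f :: "complex \<Rightarrow> complex"
  assumes "compact K" "continuous_on K f" "\<exists>w\<in>K. f w \<noteq> 0"
  shows "sup_norm K f > 0"
proof -
  obtain w where w: "w \<in> K" "f w \<noteq> 0" using assms(3) by blast
  then have "0 < norm (f w)" by simp
  also have "\<dots> \<le> sup_norm K f"
    using norm_le_sup_norm[OF compact_imp_bdd_above_norm[OF assms(1,2)] w(1)] .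
  finally show ?thesis .
qed

text \<open>Distinct nodes make the prescription well defined, a finite set is closed and discrete,
  and the Tietze extension preserves the bound 1.\<close>

lemma ex_unimodular_interpolation:
  fixes \<xi> \<eta> :: "nat \<Rightarrow> complex"
  assumes "inj_on \<xi> {1..M}" "\<xi> ` {1..M} \<subseteq> K" "\<And>i. i \<in> {1..M} \<Longrightarrow> cmod (\<eta> i) = 1"
  obtains f where "continuous_on K f" "\<And>w. w \<in> K \<Longrightarrow> cmod (f w) \<le> 1"
    "\<And>i. i \<in> {1..M} \<Longrightarrow> f (\<xi> i) = \<eta> i"
proof -
  define g where "g = \<eta> \<circ> inv_into {1..M} \<xi>"
  have g: "g (\<xi> i) = \<eta> i" if "i \<in> {1..M}" for i
    using that assms(1) by (simp add: g_def)
  have "closedin (top_of_set K) (\<xi> ` {1..M})"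
    using assms(2) by (intro closed_subset finite_imp_closed) auto
  moreover have "continuous_on (\<xi> ` {1..M}) g" by (intro continuous_on_finite) auto
  moreover have "cmod (g x) \<le> 1" if "x \<in> \<xi> ` {1..M}" for x
    using that g assms(3) by auto
  ultimately obtain f where "continuous_on K f" "\<And>x. x \<in> \<xi> ` {1..M} \<Longrightarrow> f x = g x"
    "\<And>x. x \<in> K \<Longrightarrow> cmod (f x) \<le> 1"
    using Tietze[of "\<xi> ` {1..M}" g K 1] by (metis zero_le_one)
  then show ?thesis using that g by (metis image_eqI)
qed

theorem proposition2:
  fixes s n M :: nat and m :: real
    and \<kappa> :: "nat \<Rightarrow> arc_kind" and z :: "nat \<Rightarrow> real \<Rightarrow> complex"
    and k N :: "nat \<Rightarrow> nat" and a b :: "nat \<Rightarrow> real"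
    and \<Gamma> K Z :: "complex set" and T :: "nat \<Rightarrow> real set"
    and L :: "(complex \<Rightarrow> complex) \<Rightarrow> complex poly"
    and \<xi> :: "nat \<Rightarrow> complex" and \<phi> :: "nat \<Rightarrow> complex poly"
  assumes s: "s \<ge> 1"
    and ab: "\<And>j. j \<in> {1..s} \<Longrightarrow> a j < b j"
    and k: "\<And>j. j \<in> {1..s} \<Longrightarrow> k j \<ge> 1"
    and z: "\<And>j. j \<in> {1..s} \<Longrightarrow> is_arc_map (\<kappa> j) (z j) (k j) (a j) (b j)"
    and \<Gamma>: "\<Gamma> = (\<Union>j\<in>{1..s}. z j ` {a j..b j})"
    and K: "compact K" "outer_boundary K \<subseteq> \<Gamma>" "\<Gamma> \<subseteq> K"
    and n: "n \<ge> 1" and m: "m > 1"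
    and N: "\<And>j. j \<in> {1..s} \<Longrightarrow> real (N j) = num_points (\<kappa> j) m n (k j)"
    and T: "\<And>\<nu>. \<nu> \<ge> 1 \<Longrightarrow> T \<nu> = cheb_zeros \<nu> \<or> T \<nu> = cheb_extrema \<nu>"
    and Z: "Z = (\<Union>j\<in>{1..s}. mapped_points T (\<kappa> j) (z j) (a j) (b j) (N j))"
    and \<xi>: "inj_on \<xi> {1..M}" "\<xi> ` {1..M} \<subseteq> K"
    and \<phi>: "module.span smult (\<phi> ` {1..M}) = Pn n"
    and L: "linear_projection K n L"
    and L_form: "\<And>f. continuous_on K f \<Longrightarrow> L f = (\<Sum>i = 1..M. smult (f (\<xi> i)) (\<phi> i))"
  shows "sup_norm Z (lebesgue_fun \<phi> M) \<le> op_norm K L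
    \<and> op_norm K L \<le> cheb_const m * sup_norm Z (lebesgue_fun \<phi> M)
    \<and> 0 \<le> op_norm K L - sup_norm Z (lebesgue_fun \<phi> M)
    \<and> op_norm K L - sup_norm Z (lebesgue_fun \<phi> M) \<le> (cheb_const m - 1) * op_norm K L"
proof -
  define \<Lambda> where "\<Lambda> = lebesgue_fun \<phi> M"
  define c where "c = cheb_const m"
  have c0: "0 < cos (pi / (2 * m))" using cos_mesh_pos m .
  then have c1: "c \<ge> 1" by (simp add: c_def cheb_const_def)
  have N1: "N j \<ge> 1" if "j \<in> {1..s}" for j
  proof -
    have "num_points (\<kappa> j) m n (k j) > 0" using m n k[OF that] by (cases "\<kappa> j") auto
    then show ?thesis using N[OF that] by linarith
  qed
  have T': "T (N j) = cheb_zeros (N j) \<or> T (N j) = cheb_extrema (N j)" if "j \<in> {1..s}" for j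
    using T N1 that by blast
  have T_fin: "finite (T (N j))" "T (N j) \<noteq> {}" if "j \<in> {1..s}" for j
    using T'[OF that] N1[OF that] by (auto simp: cheb_zeros_def cheb_extrema_def)
  have Z_fin: "finite Z" using T_fin(1) by (simp add: Z mapped_points_def)
  have "1 \<in> {1..s}" using s by simp
  then have "Z \<noteq> {}" using T_fin(2)[of 1] unfolding Z mapped_points_def by blast
  have "Z \<subseteq> \<Gamma>"
  proof -
    have "mapped_points T (\<kappa> j) (z j) (a j) (b j) (N j) \<subseteq> z j ` {a j..b j}" if "j \<in> {1..s}" for j
      unfolding mapped_points_def
      using cheb_map_image[OF ab[OF that] z[OF that]] cheb_nodes_subset[OF T'[OF that]] by blast
    then show ?thesis unfolding Z \<Gamma> by blast
  qed
  then have "Z \<subseteq> K" using K(3) by blast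
  then have "K \<noteq> {}" using \<open>Z \<noteq> {}\<close> by blast
  have \<Lambda>_bdd: "bdd_above ((\<lambda>w. norm (\<Lambda> w)) ` Z)" using Z_fin by (intro bdd_above_finite) auto
  have \<Lambda>_le: "\<Lambda> w \<le> sup_norm Z \<Lambda>" if "w \<in> Z" for w
    using norm_le_sup_norm[OF \<Lambda>_bdd that] by simp
  have \<Lambda>_nonneg: "0 \<le> \<Lambda> w" for w by (simp add: \<Lambda>_def lebesgue_fun_def sum_nonneg)
  have norming: "cmod (poly p w) \<le> c * B"
    if p: "degree p \<le> n" and B: "\<And>v. v \<in> Z \<Longrightarrow> cmod (poly p v) \<le> B" and w: "w \<in> K" for p w B
  proof (rule maximum_modulus_outer_boundary[OF K(1) _ w])
    fix x assume "x \<in> outer_boundary K"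
    then obtain j t where j: "j \<in> {1..s}" and t: "t \<in> {a j..b j}" "x = z j t"
      using K(2) unfolding \<Gamma> by blast
    obtain v where v: "v \<in> T (N j)"
      "cmod (poly p (z j t)) \<le> cheb_const m * cmod (poly p (z j (cheb_map (\<kappa> j) (a j) (b j) v)))"
      using norming_arc[OF ab[OF j] z[OF j] k[OF j] n m N[OF j] T'[OF j] p t(1)] by blast
    have "z j (cheb_map (\<kappa> j) (a j) (b j) v) \<in> Z"
      using v(1) j unfolding Z mapped_points_def by blast
    then have "c * cmod (poly p (z j (cheb_map (\<kappa> j) (a j) (b j) v))) \<le> c * B"
      using B c1 by (intro mult_left_mono) auto
    then show "cmod (poly p x) \<le> c * B" using v(2) t(2) by (simp add: c_def)
  qed
  have Lf: "cmod (poly (L f) w) \<le> R * \<Lambda> w"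
    if f: "continuous_on K f" "\<And>x. x \<in> K \<Longrightarrow> cmod (f x) \<le> R" for f w R
  proof -
    have "cmod (poly (L f) w) \<le> (\<Sum>i = 1..M. cmod (f (\<xi> i) * poly (\<phi> i) w))"
      unfolding L_form[OF f(1)] poly_sum poly_smult by (rule norm_sum)
    also have "\<dots> \<le> (\<Sum>i = 1..M. R * cmod (poly (\<phi> i) w))"
      using f(2) \<xi>(2) by (intro sum_mono) (auto simp: norm_mult image_subset_iff intro!: mult_right_mono)
    finally show ?thesis by (simp add: \<Lambda>_def lebesgue_fun_def sum_distrib_left)
  qed
  \<comment> \<open>Besides the upper estimate, this supplies the boundedness that makes each
    quotient at most the supremum in \<open>op_norm\<close>.\<close>
  have ratio: "sup_norm K (poly (L f)) / sup_norm K f \<le> c * sup_norm Z \<Lambda>"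
    if f: "continuous_on K f" "\<exists>w\<in>K. f w \<noteq> 0" for f
  proof -
    define R where "R = sup_norm K f"
    have R: "R > 0" unfolding R_def by (rule sup_norm_pos[OF K(1) f])
    have fR: "cmod (f x) \<le> R" if "x \<in> K" for x
      unfolding R_def using norm_le_sup_norm[OF compact_imp_bdd_above_norm[OF K(1) f(1)] that] .
    have "cmod (poly (L f) v) \<le> R * sup_norm Z \<Lambda>" if "v \<in> Z" for v
      using Lf[OF f(1) fR, of v] mult_left_mono[OF \<Lambda>_le[OF that], of R] R by linarith
    moreover have "degree (L f) \<le> n"
      using L f(1) by (auto simp: linear_projection_def Pn_def)
    ultimately have "cmod (poly (L f) w) \<le> c * (R * sup_norm Z \<Lambda>)" if "w \<in> K" for w
      using norming that by blast
    then have "sup_norm K (poly (L f)) \<le> c * (R * sup_norm Z \<Lambda>)"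
      unfolding sup_norm_def[of K] using \<open>K \<noteq> {}\<close> by (intro cSUP_least) auto
    then show ?thesis using R by (simp add: R_def[symmetric] field_simps)
  qed
  define \<F> where "\<F> = {f :: complex \<Rightarrow> complex. continuous_on K f \<and> (\<exists>w\<in>K. f w \<noteq> 0)}"
  have one: "(\<lambda>_. 1) \<in> \<F>" using \<open>K \<noteq> {}\<close> by (auto simp: \<F>_def)
  have upper: "op_norm K L \<le> c * sup_norm Z \<Lambda>"
    unfolding op_norm_def \<F>_def[symmetric]
  proof (rule cSUP_least)
    show "\<F> \<noteq> {}" using one by blast
  qed (use ratio in \<open>auto simp: \<F>_def\<close>)
  have ratio_le: "sup_norm K (poly (L f)) / sup_norm K f \<le> op_norm K L"
    if "continuous_on K f" "\<exists>w\<in>K. f w \<noteq> 0" for f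
    unfolding op_norm_def
    by (rule cSUP_upper) (use that ratio in \<open>auto intro!: bdd_aboveI2[where M = "c * sup_norm Z \<Lambda>"]\<close>)
  have poly_le: "cmod (poly (L f) w) \<le> sup_norm K (poly (L f))" if "w \<in> K" for f w
    using that by (intro norm_le_sup_norm compact_imp_bdd_above_norm K(1) continuous_intros)
  \<comment> \<open>The constant function 1 provides a nonnegative quotient under the
    supremum.\<close>
  have op_nonneg: "0 \<le> op_norm K L"
  proof -
    obtain w where w: "w \<in> K" using \<open>K \<noteq> {}\<close> by blast
    have "0 \<le> cmod (poly (L (\<lambda>_. 1)) w)" by simp
    also have "\<dots> \<le> sup_norm K (poly (L (\<lambda>_. 1)))" by (rule poly_le[OF w])
    finally have "0 \<le> sup_norm K (poly (L (\<lambda>_. 1))) / sup_norm K (\<lambda>_. 1 :: complex)"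
      using sup_norm_pos[OF K(1), of "\<lambda>_. 1"] w by (intro divide_nonneg_pos) auto
    also have "\<dots> \<le> op_norm K L" using w by (intro ratio_le) auto
    finally show ?thesis .
  qed
  have "\<Lambda> w \<le> op_norm K L" if w: "w \<in> K" for w
  \<comment> \<open>Without nodes the interpolant below might vanish on \<open>K\<close> and would
    not be admissible in the supremum.\<close>
  proof (cases "M = 0")
    case True
    then show ?thesis using op_nonneg by (simp add: \<Lambda>_def lebesgue_fun_def)
  next
    case False
    \<comment> \<open>The conjugate phases turn the sum for \<open>L f\<close> at \<open>w\<close>
      into \<open>\<Lambda> w\<close>. The default 1 is needed because \<open>sgn 0 = 0\<close>,
      while the interpolated values must have modulus 1.\<close>
    define \<eta> where "\<eta> = (\<lambda>i. if poly (\<phi> i) w = 0 then 1 else cnj (sgn (poly (\<phi> i) w)))"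
    have \<eta>1: "cmod (\<eta> i) = 1" for i by (simp add: \<eta>_def norm_sgn)
    have \<eta>\<phi>: "\<eta> i * poly (\<phi> i) w = of_real (cmod (poly (\<phi> i) w))" for i
    proof (cases "poly (\<phi> i) w = 0")
      case False
      have "cnj (poly (\<phi> i) w) * poly (\<phi> i) w = of_real (cmod (poly (\<phi> i) w)) * of_real (cmod (poly (\<phi> i) w))"
        using complex_norm_square[of "poly (\<phi> i) w"] by (simp only: mult.commute power2_eq_square of_real_mult)
      then show ?thesis using False by (simp add: \<eta>_def sgn_eq)
    qed simp
    obtain f where f: "continuous_on K f" "\<And>x. x \<in> K \<Longrightarrow> cmod (f x) \<le> 1"
      "\<And>i. i \<in> {1..M} \<Longrightarrow> f (\<xi> i) = \<eta> i"
      using ex_unimodular_interpolation[OF \<xi>, of \<eta>] \<eta>1 by blast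
    have "1 \<in> {1..M}" using False by simp
    then have nz: "\<exists>x\<in>K. f x \<noteq> 0"
      using f(3)[of 1] \<eta>1[of 1] \<xi>(2) by (metis image_subset_iff norm_zero zero_neq_one)
    have "poly (L f) w = (\<Sum>i = 1..M. \<eta> i * poly (\<phi> i) w)"
      unfolding L_form[OF f(1)] poly_sum poly_smult using f(3) by (intro sum.cong) auto
    also have "\<dots> = of_real (\<Lambda> w)" by (simp add: \<eta>\<phi> \<Lambda>_def lebesgue_fun_def)
    finally have eq: "cmod (poly (L f) w) = \<Lambda> w" using \<Lambda>_nonneg by simp
    have pos: "0 < sup_norm K f" by (rule sup_norm_pos[OF K(1) f(1) nz])
    have "sup_norm K f \<le> 1"
      unfolding sup_norm_def using f(2) \<open>K \<noteq> {}\<close> by (intro cSUP_least) auto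
    then have "op_norm K L * sup_norm K f \<le> op_norm K L" using op_nonneg by (rule mult_left_le)
    moreover have "sup_norm K (poly (L f)) \<le> op_norm K L * sup_norm K f"
      using ratio_le[OF f(1) nz] pos by (simp add: field_simps)
    ultimately show ?thesis using poly_le[OF w, of f] eq by linarith
  qed
  then have lower: "sup_norm Z \<Lambda> \<le> op_norm K L"
    unfolding sup_norm_def using \<open>Z \<noteq> {}\<close> \<open>Z \<subseteq> K\<close> \<Lambda>_nonneg by (intro cSUP_least) auto
  \<comment> \<open>By \<open>upper\<close> the gap is at most
    \<open>(c - 1) * sup_norm Z \<Lambda>\<close>, and \<open>lower\<close> with c \<ge> 1 replaces
    the discrete norm by the operator norm.\<close>
  have "op_norm K L - sup_norm Z \<Lambda> \<le> (c - 1) * op_norm K L"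
  proof -
    have "(c - 1) * sup_norm Z \<Lambda> \<le> (c - 1) * op_norm K L"
      using lower c1 by (intro mult_left_mono) auto
    then show ?thesis using upper by (simp add: algebra_simps)
  qed
  then show ?thesis using lower upper by (simp add: \<Lambda>_def c_def)
qed

end
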